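(* Let $E=(E^0,E^1,r,s)$ be a directed graph and let $A$ be an automaton over $E$. For $a\in A$ let $f_a:s_A(a)E^*\to r_A(a)E^*$ be the partial isomorphism determined recursively by $f_a(s_A(a))=r_A(a)$, $f_a(e)=a\cdot e$ for $e\in s_A(a)E^1$, and $f_a(e\mu)=(a\cdot e)f_{a|_e}(\mu)$ for $e\mu\in s_A(a)E^*$ with $e\in E^1$. Let $G_A$ be the subgroupoid of $\mathrm{PIso}(E^* )$ generated by $\{f_a:a\in A\}$ (which by convention includes the identity morphisms $\{\mathrm{id}_v:v\in E^0\}$). Then $G_A$ acts faithfully on the path space $E^*$, and this action is self-similar.
   Context: Graphs: for a directed graph $E=(E^0,E^1,r,s)$, $E^k$ is the set of paths $\mu=\mu_1\cdots\mu_k$ with $\mu_i\in E^1$ and $s(\mu_i)=r(\mu_{i+1})$; $r(\mu)=r(\mu_1)$, $s(\mu)=s(\mu_k)$; vertices are paths of length $0$ with $r(v)=s(v)=v$; $E^*=\bigsqcup_{k\ge0}E^k$; $vE^k=\{\mu\in E^k:r(\mu)=v\}$, $vE^*=\bigsqcup_kvE^k$. For clarity write $r_E=r$, $s_E=s$. Automata: an automaton over $E$ is a finite set $A$ containing $E^0$, together with functions $r_A,s_A:A\to E^0$ with $r_A(v)=v=s_A(v)$ for $v\in E^0\subset A$, and a function $(a,e)\mapsto(a\cdot e,a|_e)$ from $\{(a,e)\in A\times E^1:s_A(a)=r_E(e)\}$ to $\{(f,b)\in E^1\times A:s_E(f)=r_A(b)\}$ such that: (A1) for every $a\in A$, $e\mapsto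 a\cdot e$ is a bijection of $s_A(a)E^1$ onto $r_A(a)E^1$; (A2) $s_A(a|_e)=s_E(e)$ for all such $(a,e)$; (A3) $r_E(e)\cdot e=e$ and $r_E(e)|_e=s_E(e)$ for all $e\in E^1$. Partial isomorphisms: a partial isomorphism of $E^*$ is a bijection $g:vE^*\to wE^*$ ($v,w\in E^0$) that maps $vE^k$ bijectively onto $wE^k$ for all $k\ge0$ and satisfies $g(\mu e)\in g(\mu)E^1$ for all $\mu e\in vE^*$ with $e\in E^1$; $d(g)=v$, $c(g)=w$. The set $\mathrm{PIso}(E^* )$ of these is a groupoid (small category with inverses) with unit space $E^0$ under composition, with identities $\mathrm{id}_v:vE^*\to vE^*$. A subgroupoid here has the same unit space. Actions: an action of a groupoid $G$ with unit space $E^0$ on $E^*$ is a unit-preserving groupoid homomorphism $G\to\mathrm{PIso}(E^* )$, written $g\cdot\mu$; it is faithful if injective. A faithful action is self-similar if for every $g\in G$ and $e\in d(g)E^1$ there exists $h\in G$ such that $g\cdot(e\mu)=(g\cdot e)(h\cdot\mu)$ for all $\mu\in s(e)E^*$. *)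

theory Defs
  imports "Graph_Theory.Digraph" "HOL-Library.FuncSet"
begin

section \<open>Paths in a directed graph\<close>

text \<open>
  For a graph \<open>E\<close> of type \<open>('a, 'e) pre_digraph\<close>, the vertex set \<open>E\<^sup>0\<close> is \<open>verts E\<close>, the edge set
  \<open>E\<^sup>1\<close> is \<open>arcs E\<close>, the range map \<open>r\<close> is \<open>head E\<close> and the source map \<open>s\<close> is \<open>tail E\<close>. Paths are
  written from range to source, so consecutive edges satisfy \<open>s(\<mu>\<^sub>i) = r(\<mu>\<^sub>i\<^sub>+\<^sub>1)\<close>; this is opposite
  to the direction of walks in \<open>Graph_Theory\<close>.

  A path \<open>\<mu>\<close> is encoded as the pair of its range \<open>r(\<mu>)\<close> and its list of edges, so that the vertex \<open>v\<close>,
  as a path of length 0, is \<open>(v, [])\<close>.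
\<close>

type_synonym ('a, 'e) path = "'a \<times> 'e list"

definition rng_path :: "('a, 'e) path \<Rightarrow> 'a" where
  "rng_path \<mu> = fst \<mu>"

definition src_path :: "('a, 'e) pre_digraph \<Rightarrow> ('a, 'e) path \<Rightarrow> 'a" where
  "src_path E \<mu> = (if snd \<mu> = [] then fst \<mu> else tail E (last (snd \<mu>)))"

definition vertex_path :: "'a \<Rightarrow> ('a, 'e) path" where
  "vertex_path v = (v, [])"

definition edge_path :: "('a, 'e) pre_digraph \<Rightarrow> 'e \<Rightarrow> ('a, 'e) path" where
  "edge_path E e = (head E e, [e])"

text \<open>Concatenation \<open>\<mu>\<nu>\<close> is meaningful only if \<open>s(\<mu>) = r(\<nu>)\<close>.\<close>

definition concat_path :: "('a, 'e) path \<Rightarrow> ('a, 'e) path \<Rightarrow> ('a, 'e) path"  (infixr "\<cdot>" 70) where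
  "\<mu> \<cdot> \<nu> = (fst \<mu>, snd \<mu> @ snd \<nu>)"

definition paths_of_length :: "('a, 'e) pre_digraph \<Rightarrow> nat \<Rightarrow> ('a, 'e) path set" where
  "paths_of_length E k =
     {(v, es). v \<in> verts E \<and> length es = k \<and> set es \<subseteq> arcs E
        \<and> (es \<noteq> [] \<longrightarrow> head E (hd es) = v)
        \<and> successively (\<lambda>e f. tail E e = head E f) es}"

definition paths_at_of_length :: "('a, 'e) pre_digraph \<Rightarrow> 'a \<Rightarrow> nat \<Rightarrow> ('a, 'e) path set" where
  "paths_at_of_length E v k = {\<mu> \<in> paths_of_length E k. rng_path \<mu> = v}"

definition paths_at :: "('a, 'e) pre_digraph \<Rightarrow> 'a \<Rightarrow> ('a, 'e) path set" where
  "paths_at E v = (\<Union>k. paths_at_of_length E v k)"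

definition edges_at :: "('a, 'e) pre_digraph \<Rightarrow> 'a \<Rightarrow> 'e set" where
  "edges_at E v = {e \<in> arcs E. head E e = v}"


section \<open>Groupoids\<close>

text \<open>
  A groupoid is a small category with inverses. The field \<open>Unit\<close> is the unit space and \<open>Ident\<close> sends
  a unit to its identity morphism. The composite \<open>Comp G g h\<close> (first \<open>h\<close>, then \<open>g\<close>) is meaningful
  only if \<open>Dom G g = Cod G h\<close>.
\<close>

record ('o, 'm) groupoid =
  Unit :: "'o set"
  Arr :: "'m set"
  Dom :: "'m \<Rightarrow> 'o"
  Cod :: "'m \<Rightarrow> 'o"
  Ident :: "'o \<Rightarrow> 'm"
  Comp :: "'m \<Rightarrow> 'm \<Rightarrow> 'm"

definition inverse_arr :: "('o, 'm) groupoid \<Rightarrow> 'm \<Rightarrow> 'm \<Rightarrow> bool" where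
  "inverse_arr G g h \<longleftrightarrow> h \<in> Arr G \<and> Dom G h = Cod G g \<and> Cod G h = Dom G g
     \<and> Comp G h g = Ident G (Dom G g) \<and> Comp G g h = Ident G (Cod G g)"

locale groupoid =
  fixes G :: "('o, 'm) groupoid"
  assumes Dom_in: "g \<in> Arr G \<Longrightarrow> Dom G g \<in> Unit G"
    and Cod_in: "g \<in> Arr G \<Longrightarrow> Cod G g \<in> Unit G"
    and Ident_in: "v \<in> Unit G \<Longrightarrow> Ident G v \<in> Arr G"
    and Dom_Ident: "v \<in> Unit G \<Longrightarrow> Dom G (Ident G v) = v"
    and Cod_Ident: "v \<in> Unit G \<Longrightarrow> Cod G (Ident G v) = v"
    and Comp_in: "\<lbrakk>g \<in> Arr G; h \<in> Arr G; Dom G g = Cod G h\<rbrakk> \<Longrightarrow> Comp G g h \<in> Arr G"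
    and Dom_Comp: "\<lbrakk>g \<in> Arr G; h \<in> Arr G; Dom G g = Cod G h\<rbrakk> \<Longrightarrow> Dom G (Comp G g h) = Dom G h"
    and Cod_Comp: "\<lbrakk>g \<in> Arr G; h \<in> Arr G; Dom G g = Cod G h\<rbrakk> \<Longrightarrow> Cod G (Comp G g h) = Cod G g"
    and Comp_assoc: "\<lbrakk>g \<in> Arr G; h \<in> Arr G; k \<in> Arr G; Dom G g = Cod G h; Dom G h = Cod G k\<rbrakk>
      \<Longrightarrow> Comp G (Comp G g h) k = Comp G g (Comp G h k)"
    and Comp_Ident_right: "g \<in> Arr G \<Longrightarrow> Comp G g (Ident G (Dom G g)) = g"
    and Comp_Ident_left: "g \<in> Arr G \<Longrightarrow> Comp G (Ident G (Cod G g)) g = g"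
    and ex_inverse: "g \<in> Arr G \<Longrightarrow> \<exists>h. inverse_arr G g h"

text \<open>Subgroupoids have the same unit space as the ambient groupoid.\<close>

definition is_subgroupoid :: "'m set \<Rightarrow> ('o, 'm) groupoid \<Rightarrow> bool" where
  "is_subgroupoid H G \<longleftrightarrow> H \<subseteq> Arr G
     \<and> (\<forall>v\<in>Unit G. Ident G v \<in> H)
     \<and> (\<forall>g\<in>H. \<forall>h\<in>H. Dom G g = Cod G h \<longrightarrow> Comp G g h \<in> H)
     \<and> (\<forall>g\<in>H. \<forall>h. inverse_arr G g h \<longrightarrow> h \<in> H)"

text \<open>
  If \<open>S\<close> is not contained in \<open>Arr G\<close>, the intersection below is over the empty family and hence all
  of \<open>UNIV\<close>; a result placing the generated arrows in \<open>Arr G\<close> therefore also yields \<open>S \<subseteq> Arr G\<close>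
  (unless \<open>Arr G = UNIV\<close>, where this is trivial).
\<close>

definition generated_subgroupoid :: "('o, 'm) groupoid \<Rightarrow> 'm set \<Rightarrow> ('o, 'm) groupoid" where
  "generated_subgroupoid G S = G\<lparr>Arr := \<Inter>{H. is_subgroupoid H G \<and> S \<subseteq> H}\<rparr>"

locale unit_preserving_hom = G: groupoid G + H: groupoid H
  for G :: "('o, 'm) groupoid" and H :: "('o, 'n) groupoid" +
  fixes \<phi> :: "'m \<Rightarrow> 'n"
  assumes Unit_eq: "Unit G = Unit H"
    and map_in: "g \<in> Arr G \<Longrightarrow> \<phi> g \<in> Arr H"
    and map_Dom: "g \<in> Arr G \<Longrightarrow> Dom H (\<phi> g) = Dom G g"
    and map_Cod: "g \<in> Arr G \<Longrightarrow> Cod H (\<phi> g) = Cod G g"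
    and map_Ident: "v \<in> Unit G \<Longrightarrow> \<phi> (Ident G v) = Ident H v"
    and map_Comp: "\<lbrakk>g \<in> Arr G; h \<in> Arr G; Dom G g = Cod G h\<rbrakk>
      \<Longrightarrow> \<phi> (Comp G g h) = Comp H (\<phi> g) (\<phi> h)"


section \<open>Partial isomorphisms of the path space\<close>

text \<open>
  A partial isomorphism \<open>g : vE\<^sup>* \<rightarrow> wE\<^sup>*\<close> is recorded with \<open>d(g) = v\<close> and \<open>c(g) = w\<close>. Its underlying
  function is required to be extensional, so that equality of records is equality of
  partial isomorphisms.
\<close>

record ('a, 'e) piso =
  pdom :: 'a
  pcod :: 'a
  pmap :: "('a, 'e) path \<Rightarrow> ('a, 'e) path"

definition partial_iso :: "('a, 'e) pre_digraph \<Rightarrow> ('a, 'e) piso \<Rightarrow> bool" where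
  "partial_iso E g \<longleftrightarrow>
     pdom g \<in> verts E \<and> pcod g \<in> verts E
     \<and> pmap g \<in> extensional (paths_at E (pdom g))
     \<and> bij_betw (pmap g) (paths_at E (pdom g)) (paths_at E (pcod g))
     \<and> (\<forall>k. bij_betw (pmap g) (paths_at_of_length E (pdom g) k) (paths_at_of_length E (pcod g) k))
     \<and> (\<forall>\<mu>\<in>paths_at E (pdom g). \<forall>e\<in>edges_at E (src_path E \<mu>).
          \<exists>f\<in>edges_at E (src_path E (pmap g \<mu>)).
            pmap g (\<mu> \<cdot> edge_path E e) = pmap g \<mu> \<cdot> edge_path E f)"

definition PIso :: "('a, 'e) pre_digraph \<Rightarrow> ('a, ('a, 'e) piso) groupoid" where
  "PIso E = \<lparr>
     Unit = verts E,
     Arr = {g. partial_iso E g},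
     Dom = pdom,
     Cod = pcod,
     Ident = (\<lambda>v. \<lparr>pdom = v, pcod = v, pmap = (\<lambda>\<mu>\<in>paths_at E v. \<mu>)\<rparr>),
     Comp = (\<lambda>g h. \<lparr>pdom = pdom h, pcod = pcod g,
                    pmap = compose (paths_at E (pdom h)) (pmap g) (pmap h)\<rparr>)\<rparr>"


section \<open>Groupoid actions on the path space\<close>

text \<open>The action of \<open>g\<close> on a path \<open>\<mu>\<close> in \<open>d(g)E\<^sup>*\<close> is \<open>g \<cdot> \<mu> = pmap (\<phi> g) \<mu>\<close>.\<close>

locale groupoid_action = wf_digraph E + unit_preserving_hom G "PIso E" \<phi>
  for E :: "('a, 'e) pre_digraph" and G :: "('a, 'm) groupoid" and \<phi> :: "'m \<Rightarrow> ('a, 'e) piso"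

locale faithful_action = groupoid_action E G \<phi>
  for E :: "('a, 'e) pre_digraph" and G :: "('a, 'm) groupoid" and \<phi> :: "'m \<Rightarrow> ('a, 'e) piso" +
  assumes faithful: "inj_on \<phi> (Arr G)"

text \<open>
  The conditions on \<open>Dom G h\<close> and \<open>Cod G h\<close> are those needed for \<open>h \<cdot> \<mu>\<close> and for the
  concatenation \<open>(g \<cdot> e)(h \<cdot> \<mu>)\<close> to be defined.
\<close>

locale self_similar_action = faithful_action E G \<phi>
  for E :: "('a, 'e) pre_digraph" and G :: "('a, 'm) groupoid" and \<phi> :: "'m \<Rightarrow> ('a, 'e) piso" +
  assumes self_similar: "\<lbrakk>g \<in> Arr G; e \<in> edges_at E (Dom G g)\<rbrakk> \<Longrightarrow>
    \<exists>h\<in>Arr G. Dom G h = tail E e \<and> Cod G h = src_path E (pmap (\<phi> g) (edge_path E e))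
      \<and> (\<forall>\<mu>\<in>paths_at E (tail E e).
            pmap (\<phi> g) (edge_path E e \<cdot> \<mu>) = pmap (\<phi> g) (edge_path E e) \<cdot> pmap (\<phi> h) \<mu>)"


section \<open>Automata\<close>

text \<open>
  The type \<open>'a\<close> serves as a common universe for the vertices of the graph and the states of the
  automaton, so that the requirement \<open>E\<^sup>0 \<subseteq> A\<close> is literal set inclusion.
  The functions \<open>act\<close> and \<open>res\<close> are \<open>(a, e) \<mapsto> a \<cdot> e\<close> and \<open>(a, e) \<mapsto> a|\<^sub>e\<close>.
\<close>

record ('a, 'e) automaton =
  states :: "'a set"
  rng :: "'a \<Rightarrow> 'a"
  src :: "'a \<Rightarrow> 'a"
  act :: "'a \<Rightarrow> 'e \<Rightarrow> 'e"
  res :: "'a \<Rightarrow> 'e \<Rightarrow> 'a"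

locale automaton = wf_digraph E
  for E :: "('a, 'e) pre_digraph" +
  fixes A :: "('a, 'e) automaton"
  assumes finite_states: "finite (states A)"
    and verts_subset: "verts E \<subseteq> states A"
    and rng_in: "a \<in> states A \<Longrightarrow> rng A a \<in> verts E"
    and src_in: "a \<in> states A \<Longrightarrow> src A a \<in> verts E"
    and rng_vert: "v \<in> verts E \<Longrightarrow> rng A v = v"
    and src_vert: "v \<in> verts E \<Longrightarrow> src A v = v"
    and act_in: "\<lbrakk>a \<in> states A; e \<in> edges_at E (src A a)\<rbrakk> \<Longrightarrow> act A a e \<in> arcs E"
    and res_in: "\<lbrakk>a \<in> states A; e \<in> edges_at E (src A a)\<rbrakk> \<Longrightarrow> res A a e \<in> states A"
    and tail_act: "\<lbrakk>a \<in> states A; e \<in> edges_at E (src A a)\<rbrakk>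
      \<Longrightarrow> tail E (act A a e) = rng A (res A a e)"
    and A1: "a \<in> states A \<Longrightarrow> bij_betw (act A a) (edges_at E (src A a)) (edges_at E (rng A a))"
    and A2: "\<lbrakk>a \<in> states A; e \<in> edges_at E (src A a)\<rbrakk> \<Longrightarrow> src A (res A a e) = tail E e"
    and A3_act: "e \<in> arcs E \<Longrightarrow> act A (head E e) e = e"
    and A3_res: "e \<in> arcs E \<Longrightarrow> res A (head E e) e = tail E e"

primrec act_word :: "('a, 'e) automaton \<Rightarrow> 'a \<Rightarrow> 'e list \<Rightarrow> 'e list" where
  "act_word A a [] = []"
| "act_word A a (e # es) = act A a e # act_word A (res A a e) es"

text \<open>
  The partial isomorphism \<open>f\<^sub>a\<close>. Lemma \<open>aut_piso_recursion\<close> shows that it satisfies its defining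
  recursion and \<open>aut_piso_unique\<close> that this recursion determines it.
\<close>

definition aut_piso :: "('a, 'e) pre_digraph \<Rightarrow> ('a, 'e) automaton \<Rightarrow> 'a \<Rightarrow> ('a, 'e) piso" where
  "aut_piso E A a = \<lparr>pdom = src A a, pcod = rng A a,
     pmap = (\<lambda>\<mu>\<in>paths_at E (src A a). (rng A a, act_word A a (snd \<mu>)))\<rparr>"

lemma vertex_path_in_paths_at: "v \<in> verts E \<Longrightarrow> vertex_path v \<in> paths_at E v"
  by (auto simp: vertex_path_def paths_at_def paths_at_of_length_def paths_of_length_def rng_path_def)

lemma paths_at_cons_iff:
  "(v, e # es) \<in> paths_at E v \<longleftrightarrow>
     v \<in> verts E \<and> e \<in> edges_at E v \<and> (tail E e, es) \<in> paths_at E (tail E e)"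
  if "wf_digraph E"
  using wf_digraph.tail_in_verts[OF that]
  by (cases es) (auto simp: paths_at_def paths_at_of_length_def paths_of_length_def rng_path_def edges_at_def)

lemma rng_paths_at: "\<mu> \<in> paths_at E v \<Longrightarrow> \<mu> = (v, snd \<mu>) \<and> v \<in> verts E"
  by (auto simp: paths_at_def paths_at_of_length_def paths_of_length_def rng_path_def)

context automaton
begin

lemma edge_concat_in_paths_at:
  assumes "e \<in> edges_at E v" "\<mu> \<in> paths_at E (tail E e)"
  shows "edge_path E e \<cdot> \<mu> \<in> paths_at E v"
proof -
  have "e \<in> arcs E" "head E e = v" using assms(1) by (auto simp: edges_at_def)
  moreover from this have "v \<in> verts E" using head_in_verts by blast
  ultimately show ?thesis
    using assms rng_paths_at[OF assms(2)] paths_at_cons_iff[OF wf_digraph, of v e "snd \<mu>"]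
    by (auto simp: edge_path_def concat_path_def)
qed

lemma aut_piso_recursion:
  assumes a: "a \<in> states A"
  shows "pmap (aut_piso E A a) (vertex_path (src A a)) = vertex_path (rng A a)"
    and "e \<in> edges_at E (src A a) \<Longrightarrow>
      pmap (aut_piso E A a) (edge_path E e) = edge_path E (act A a e)"
    and "\<lbrakk>e \<in> edges_at E (src A a); \<mu> \<in> paths_at E (tail E e)\<rbrakk> \<Longrightarrow>
      pmap (aut_piso E A a) (edge_path E e \<cdot> \<mu>)
        = edge_path E (act A a e) \<cdot> pmap (aut_piso E A (res A a e)) \<mu>"
proof -
  have head_act: "head E (act A a e) = rng A a" if "e \<in> edges_at E (src A a)" for e
    using A1[OF a] that by (auto simp: edges_at_def dest: bij_betw_apply)
  show "pmap (aut_piso E A a) (vertex_path (src A a)) = vertex_path (rng A a)"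
    using vertex_path_in_paths_at[OF src_in[OF a]]
    by (simp add: aut_piso_def) (simp add: vertex_path_def)
  show rec: "pmap (aut_piso E A a) (edge_path E e \<cdot> \<mu>)
        = edge_path E (act A a e) \<cdot> pmap (aut_piso E A (res A a e)) \<mu>"
    if "e \<in> edges_at E (src A a)" "\<mu> \<in> paths_at E (tail E e)" for e \<mu>
    using edge_concat_in_paths_at[OF that] that A2[OF a that(1)] head_act[OF that(1)]
    by (simp add: aut_piso_def) (simp add: edge_path_def concat_path_def)
  show "pmap (aut_piso E A a) (edge_path E e) = edge_path E (act A a e)"
    if e: "e \<in> edges_at E (src A a)" for e
  proof -
    have "vertex_path (tail E e) \<in> paths_at E (tail E e)"
      using e by (intro vertex_path_in_paths_at tail_in_verts) (simp add: edges_at_def)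
    from edge_concat_in_paths_at[OF e this] have "edge_path E e \<in> paths_at E (src A a)"
      by (simp add: concat_path_def vertex_path_def edge_path_def)
    then show ?thesis
      using head_act[OF e] by (simp add: aut_piso_def) (simp add: edge_path_def)
  qed
qed

lemma aut_piso_unique:
  assumes "\<And>a. a \<in> states A \<Longrightarrow> f a (vertex_path (src A a)) = vertex_path (rng A a)"
    and "\<And>a e \<mu>. \<lbrakk>a \<in> states A; e \<in> edges_at E (src A a); \<mu> \<in> paths_at E (tail E e)\<rbrakk>
      \<Longrightarrow> f a (edge_path E e \<cdot> \<mu>) = edge_path E (act A a e) \<cdot> f (res A a e) \<mu>"
    and "a \<in> states A" "\<mu> \<in> paths_at E (src A a)"
  shows "f a \<mu> = pmap (aut_piso E A a) \<mu>"
proof -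
  have "f a (src A a, es) = pmap (aut_piso E A a) (src A a, es)"
    if "(src A a, es) \<in> paths_at E (src A a)" "a \<in> states A" for es
    using that
  proof (induction es arbitrary: a)
    case Nil
    then show ?case
      using assms(1) aut_piso_recursion(1) by (simp add: vertex_path_def)
  next
    case (Cons e es)
    have e: "e \<in> edges_at E (src A a)" and es: "(tail E e, es) \<in> paths_at E (tail E e)"
      using Cons.prems(1) paths_at_cons_iff[OF wf_digraph, of "src A a" e es] tail_in_verts
      by (auto simp: edges_at_def)
    have eq: "(src A a, e # es) = edge_path E e \<cdot> (tail E e, es)"
      using e by (simp add: edge_path_def concat_path_def edges_at_def)
    have "f (res A a e) (tail E e, es) = pmap (aut_piso E A (res A a e)) (tail E e, es)"
      using Cons.IH[of "res A a e"] es A2[OF Cons.prems(2) e] res_in[OF Cons.prems(2) e] by simp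
    then show ?case
      unfolding eq using assms(2) aut_piso_recursion(3) Cons.prems(2) e es by simp
  qed
  then show ?thesis
    using assms(3,4) rng_paths_at by metis
qed

end

definition automaton_groupoid ::
    "('a, 'e) pre_digraph \<Rightarrow> ('a, 'e) automaton \<Rightarrow> ('a, ('a, 'e) piso) groupoid" where
  "automaton_groupoid E A = generated_subgroupoid (PIso E) (aut_piso E A ` states A)"

end

theory Submission
  imports Defs
begin

text \<open>
  Self-similarity is checked on generators: the elements \<open>g\<close> of \<open>G\<^sub>A\<close> that have, for every edge
  \<open>e\<close>, a restriction \<open>g|\<^sub>e\<close> in \<open>G\<^sub>A\<close> form a subgroupoid, because \<open>id\<^sub>v|\<^sub>e = id\<close>,
  \<open>(g g')|\<^sub>e = g|\<^bsub>g'e\<^esub> g'|\<^sub>e\<close> and \<open>g\<inverse>|\<^sub>e = (g|\<^sub>f)\<inverse>\<close> with \<open>f = g\<inverse>e\<close>. It contains every \<open>f\<^sub>a\<close>, whose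
  restriction to \<open>e\<close> is \<open>f\<^sub>b\<close> with \<open>b = a|\<^sub>e\<close>, so it is all of \<open>G\<^sub>A\<close>.
\<close>

section \<open>Subgroupoids\<close>

lemma is_subgroupoidD:
  assumes "is_subgroupoid H G"
  shows "g \<in> H \<Longrightarrow> g \<in> Arr G"
    and "v \<in> Unit G \<Longrightarrow> Ident G v \<in> H"
    and "\<lbrakk>g \<in> H; h \<in> H; Dom G g = Cod G h\<rbrakk> \<Longrightarrow> Comp G g h \<in> H"
    and "\<lbrakk>g \<in> H; inverse_arr G g h\<rbrakk> \<Longrightarrow> h \<in> H"
  using assms unfolding is_subgroupoid_def by blast+

text \<open>Only the arrow set changes, so the laws on domains, codomains, units and associativity
  are inherited. Identities, composites and inverses stay inside because \<open>H\<close> is closed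
  under them.\<close>

lemma (in groupoid) groupoid_subgroupoid:
  assumes H: "is_subgroupoid H G"
  shows "groupoid (G\<lparr>Arr := H\<rparr>)"
proof
  fix g assume "g \<in> Arr (G\<lparr>Arr := H\<rparr>)"
  then have g: "g \<in> H" by simp
  obtain h where h: "inverse_arr G g h"
    using ex_inverse[OF is_subgroupoidD(1)[OF H g]] by blast
  then show "\<exists>h. inverse_arr (G\<lparr>Arr := H\<rparr>) g h"
    using is_subgroupoidD(4)[OF H g h] unfolding inverse_arr_def by auto
qed (use is_subgroupoidD[OF H] in
    \<open>auto intro: Dom_in Cod_in Dom_Ident Cod_Ident Dom_Comp Cod_Comp Comp_assoc
      Comp_Ident_right Comp_Ident_left\<close>)

lemma (in groupoid) is_subgroupoid_Arr: "is_subgroupoid (Arr G) G"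
  unfolding is_subgroupoid_def by (auto intro: Ident_in Comp_in simp: inverse_arr_def)

text \<open>Since \<open>S\<close> lies in \<open>Arr G\<close>, the set \<open>Arr G\<close> is
  itself a member of the intersected family and bounds the intersection. The closure conditions pass
  to intersections.\<close>

lemma (in groupoid) is_subgroupoid_generated:
  assumes "S \<subseteq> Arr G"
  shows "is_subgroupoid (Arr (generated_subgroupoid G S)) G"
proof -
  have "Arr (generated_subgroupoid G S) \<subseteq> Arr G"
    using assms is_subgroupoid_Arr by (auto simp: generated_subgroupoid_def)
  then show ?thesis
    unfolding is_subgroupoid_def[of "Arr (generated_subgroupoid G S)"]
    by (auto simp: generated_subgroupoid_def is_subgroupoidD)
qed

lemma generator_in_generated: "g \<in> S \<Longrightarrow> g \<in> Arr (generated_subgroupoid G S)"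
  by (auto simp: generated_subgroupoid_def)

lemma generated_subset: "\<lbrakk>is_subgroupoid H G; S \<subseteq> H\<rbrakk> \<Longrightarrow> Arr (generated_subgroupoid G S) \<subseteq> H"
  by (auto simp: generated_subgroupoid_def)


section \<open>The groupoid of partial isomorphisms\<close>

lemma paths_at_of_length_eq: "paths_at_of_length E v k = {\<mu> \<in> paths_at E v. length (snd \<mu>) = k}"
  by (auto simp: paths_at_def paths_at_of_length_def paths_of_length_def)

text \<open>Prefixes of paths are again paths. Composability of an appended edge thus becomes plain
  membership in \<open>paths_at\<close>, which any bijection between path sets transports.\<close>

lemma concat_edge_in_paths_at_iff:
  "\<mu> \<cdot> edge_path E e \<in> paths_at E v \<longleftrightarrow> \<mu> \<in> paths_at E v \<and> e \<in> edges_at E (src_path E \<mu>)"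
  by (cases \<mu>; cases "snd \<mu>" rule: rev_cases)
    (auto simp: paths_at_def paths_at_of_length_def paths_of_length_def rng_path_def
      src_path_def concat_path_def edge_path_def edges_at_def successively_append_iff hd_append)

lemma paths_at_cons_iff':
  assumes "wf_digraph E"
  shows "(v, e # es) \<in> paths_at E v \<longleftrightarrow>
    e \<in> edges_at E v \<and> (tail E e, es) \<in> paths_at E (tail E e)"
  using paths_at_cons_iff[OF assms, of v e es] wf_digraph.head_in_verts[OF assms]
  by (auto simp: edges_at_def)

text \<open>Two clauses of \<open>partial_iso\<close> come for free. A length-preserving bijection
  restricts to a bijection on each level, and the edge \<open>f\<close> appended to an image is
  composable because the image of a path is again a path.\<close>

lemma partial_isoI:
  assumes "pdom g \<in> verts E" "pcod g \<in> verts E" "pmap g \<in> extensional (paths_at E (pdom g))"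
    and bij: "bij_betw (pmap g) (paths_at E (pdom g)) (paths_at E (pcod g))"
    and len: "\<And>\<mu>. \<mu> \<in> paths_at E (pdom g) \<Longrightarrow> length (snd (pmap g \<mu>)) = length (snd \<mu>)"
    and step: "\<And>\<mu> e. \<lbrakk>\<mu> \<in> paths_at E (pdom g); \<mu> \<cdot> edge_path E e \<in> paths_at E (pdom g)\<rbrakk> \<Longrightarrow>
      \<exists>f. pmap g (\<mu> \<cdot> edge_path E e) = pmap g \<mu> \<cdot> edge_path E f"
  shows "partial_iso E g"
proof -
  have "bij_betw (pmap g) (paths_at_of_length E (pdom g) k) (paths_at_of_length E (pcod g) k)" for k
  proof (rule bij_betw_subset[OF bij])
    show "pmap g ` paths_at_of_length E (pdom g) k = paths_at_of_length E (pcod g) k"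
      using len bij_betw_imp_surj_on[OF bij] by (force simp: paths_at_of_length_eq)
  qed (auto simp: paths_at_of_length_eq)
  moreover have "\<exists>f\<in>edges_at E (src_path E (pmap g \<mu>)).
      pmap g (\<mu> \<cdot> edge_path E e) = pmap g \<mu> \<cdot> edge_path E f"
    if \<mu>: "\<mu> \<in> paths_at E (pdom g)" and e: "e \<in> edges_at E (src_path E \<mu>)" for \<mu> e
  proof -
    have *: "\<mu> \<cdot> edge_path E e \<in> paths_at E (pdom g)"
      using \<mu> e by (simp add: concat_edge_in_paths_at_iff)
    then obtain f where f: "pmap g (\<mu> \<cdot> edge_path E e) = pmap g \<mu> \<cdot> edge_path E f"
      using step[OF \<mu>] by blast
    with bij_betw_apply[OF bij *] show ?thesis
      by (auto simp: concat_edge_in_paths_at_iff)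
  qed
  ultimately show ?thesis
    using assms(1-4) by (simp add: partial_iso_def)
qed

lemma partial_isoD:
  assumes "partial_iso E g"
  shows "pdom g \<in> verts E" "pcod g \<in> verts E" "pmap g \<in> extensional (paths_at E (pdom g))"
    and "bij_betw (pmap g) (paths_at E (pdom g)) (paths_at E (pcod g))"
    and "\<mu> \<in> paths_at E (pdom g) \<Longrightarrow> pmap g \<mu> \<in> paths_at E (pcod g)"
    and "\<mu> \<in> paths_at E (pdom g) \<Longrightarrow> length (snd (pmap g \<mu>)) = length (snd \<mu>)"
    and "\<mu> \<cdot> edge_path E e \<in> paths_at E (pdom g) \<Longrightarrow>
      \<exists>f. pmap g (\<mu> \<cdot> edge_path E e) = pmap g \<mu> \<cdot> edge_path E f"
proof -
  show "pdom g \<in> verts E" "pcod g \<in> verts E" "pmap g \<in> extensional (paths_at E (pdom g))"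
    and bij: "bij_betw (pmap g) (paths_at E (pdom g)) (paths_at E (pcod g))"
    using assms by (auto simp: partial_iso_def)
  show "pmap g \<mu> \<in> paths_at E (pcod g)" if "\<mu> \<in> paths_at E (pdom g)"
    using bij_betw_apply[OF bij that] .
  show "length (snd (pmap g \<mu>)) = length (snd \<mu>)" if "\<mu> \<in> paths_at E (pdom g)"
  proof -
    have "bij_betw (pmap g) (paths_at_of_length E (pdom g) (length (snd \<mu>)))
        (paths_at_of_length E (pcod g) (length (snd \<mu>)))"
      using assms by (simp add: partial_iso_def)
    from bij_betw_apply[OF this, of \<mu>] that show ?thesis
      by (simp add: paths_at_of_length_eq)
  qed
  show "\<exists>f. pmap g (\<mu> \<cdot> edge_path E e) = pmap g \<mu> \<cdot> edge_path E f"
    if "\<mu> \<cdot> edge_path E e \<in> paths_at E (pdom g)"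
    using assms that unfolding partial_iso_def concat_edge_in_paths_at_iff by blast
qed

lemma PIso_simps [simp]:
  "Unit (PIso E) = verts E"
  "g \<in> Arr (PIso E) \<longleftrightarrow> partial_iso E g"
  "Dom (PIso E) = pdom"
  "Cod (PIso E) = pcod"
  by (simp_all add: PIso_def)

lemma pdom_Ident [simp]: "pdom (Ident (PIso E) v) = v"
  and pcod_Ident [simp]: "pcod (Ident (PIso E) v) = v"
  and pmap_Ident [simp]: "pmap (Ident (PIso E) v) = (\<lambda>\<mu>\<in>paths_at E v. \<mu>)"
  by (simp_all add: PIso_def)

lemma pdom_Comp [simp]: "pdom (Comp (PIso E) g h) = pdom h"
  and pcod_Comp [simp]: "pcod (Comp (PIso E) g h) = pcod g"
  and pmap_Comp [simp]:
    "pmap (Comp (PIso E) g h) = compose (paths_at E (pdom h)) (pmap g) (pmap h)"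
  by (simp_all add: PIso_def)

text \<open>The explicit type excludes record extensions, whose further fields would also have to
  agree.\<close>

lemma piso_eqI:
  fixes g h :: "('a, 'e) piso"
  shows "\<lbrakk>pdom g = pdom h; pcod g = pcod h; pmap g = pmap h\<rbrakk> \<Longrightarrow> g = h"
  by simp

lemma partial_iso_Ident:
  assumes "v \<in> verts E"
  shows "partial_iso E (Ident (PIso E) v)"
proof (rule partial_isoI)
  show "bij_betw (pmap (Ident (PIso E) v)) (paths_at E (pdom (Ident (PIso E) v)))
      (paths_at E (pcod (Ident (PIso E) v)))"
    by (auto simp: bij_betw_def inj_on_def)
qed (use assms in auto)

lemma partial_iso_Comp:
  assumes g: "partial_iso E g" and h: "partial_iso E h" and gh: "pdom g = pcod h"
  shows "partial_iso E (Comp (PIso E) g h)"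
proof (rule partial_isoI)
  let ?c = "Comp (PIso E) g h"
  have "bij_betw (pmap g \<circ> pmap h) (paths_at E (pdom h)) (paths_at E (pcod g))"
    using bij_betw_trans[OF partial_isoD(4)[OF h]] partial_isoD(4)[OF g] gh by simp
  then show "bij_betw (pmap ?c) (paths_at E (pdom ?c)) (paths_at E (pcod ?c))"
    by (subst bij_betw_cong[where g = "pmap g \<circ> pmap h"]) (simp_all add: compose_eq)
  fix \<mu> assume \<mu>: "\<mu> \<in> paths_at E (pdom ?c)"
  then show "length (snd (pmap ?c \<mu>)) = length (snd \<mu>)"
    using gh partial_isoD(5,6)[OF h, of \<mu>] partial_isoD(6)[OF g, of "pmap h \<mu>"]
    by (simp add: compose_eq)
  fix e assume e: "\<mu> \<cdot> edge_path E e \<in> paths_at E (pdom ?c)"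
  then obtain f where f: "pmap h (\<mu> \<cdot> edge_path E e) = pmap h \<mu> \<cdot> edge_path E f"
    using partial_isoD(7)[OF h, of \<mu> e] by auto
  with e have "pmap h \<mu> \<cdot> edge_path E f \<in> paths_at E (pdom g)"
    using partial_isoD(5)[OF h, of "\<mu> \<cdot> edge_path E e"] gh by simp
  then obtain f' where "pmap g (pmap h \<mu> \<cdot> edge_path E f) = pmap g (pmap h \<mu>) \<cdot> edge_path E f'"
    using partial_isoD(7)[OF g] by blast
  then show "\<exists>f. pmap ?c (\<mu> \<cdot> edge_path E e) = pmap ?c \<mu> \<cdot> edge_path E f"
    using f \<mu> e by (auto simp: compose_eq)
qed (use assms partial_isoD in \<open>auto simp: compose_def\<close>)

text \<open>Outside the image \<open>inv_into\<close> is not \<open>undefined\<close> in general, so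
  the explicit restriction is what makes the map extensional.\<close>

definition piso_inv :: "('a, 'e) pre_digraph \<Rightarrow> ('a, 'e) piso \<Rightarrow> ('a, 'e) piso" where
  "piso_inv E g = \<lparr>pdom = pcod g, pcod = pdom g,
     pmap = (\<lambda>\<mu>\<in>paths_at E (pcod g). inv_into (paths_at E (pdom g)) (pmap g) \<mu>)\<rparr>"

lemma piso_inv_simps [simp]:
  "pdom (piso_inv E g) = pcod g" "pcod (piso_inv E g) = pdom g"
  by (simp_all add: piso_inv_def)

lemma pmap_piso_inv:
  assumes "partial_iso E g"
  shows "\<mu> \<in> paths_at E (pdom g) \<Longrightarrow> pmap (piso_inv E g) (pmap g \<mu>) = \<mu>"
    and "\<nu> \<in> paths_at E (pcod g) \<Longrightarrow> pmap g (pmap (piso_inv E g) \<nu>) = \<nu>"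
    and "\<nu> \<in> paths_at E (pcod g) \<Longrightarrow> pmap (piso_inv E g) \<nu> \<in> paths_at E (pdom g)"
  using partial_isoD(4,5)[OF assms]
  by (auto simp: piso_inv_def bij_betw_def inv_into_f_f f_inv_into_f inv_into_into)

text \<open>The clause with content is compatibility with prefixes: the preimage of a path extended
  by one edge must extend the preimage of that path.\<close>

lemma partial_iso_piso_inv:
  assumes g: "partial_iso E g"
  shows "partial_iso E (piso_inv E g)"
proof (rule partial_isoI)
  let ?k = "piso_inv E g"
  show "bij_betw (pmap ?k) (paths_at E (pdom ?k)) (paths_at E (pcod ?k))"
    by (rule bij_betw_byWitness[where f' = "pmap g"])
      (auto simp: pmap_piso_inv[OF g] partial_isoD(5)[OF g])
  fix \<mu> assume "\<mu> \<in> paths_at E (pdom ?k)"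
  then have \<mu>: "\<mu> \<in> paths_at E (pcod g)" by simp
  then show "length (snd (pmap ?k \<mu>)) = length (snd \<mu>)"
    using partial_isoD(6)[OF g pmap_piso_inv(3)[OF g \<mu>]] pmap_piso_inv(2)[OF g \<mu>] by simp
  fix e assume "\<mu> \<cdot> edge_path E e \<in> paths_at E (pdom ?k)"
  then have e: "\<mu> \<cdot> edge_path E e \<in> paths_at E (pcod g)" by simp
  define \<nu> where "\<nu> = pmap ?k (\<mu> \<cdot> edge_path E e)"
  have \<nu>: "\<nu> \<in> paths_at E (pdom g)" "pmap g \<nu> = \<mu> \<cdot> edge_path E e"
    using pmap_piso_inv[OF g] e by (auto simp: \<nu>_def)
  \<comment> \<open>As \<open>g\<close> preserves length, the preimage of a nonempty path is
    nonempty, so its last edge can be split off.\<close>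
  with partial_isoD(6)[OF g, of \<nu>] have "snd \<nu> \<noteq> []"
    by (auto simp: concat_path_def edge_path_def)
  then obtain es f where "snd \<nu> = es @ [f]"
    by (cases "snd \<nu>" rule: rev_cases) auto
  then have \<nu>': "\<nu> = (fst \<nu>, es) \<cdot> edge_path E f"
    by (auto simp: concat_path_def edge_path_def prod_eq_iff)
  then obtain f' where "pmap g \<nu> = pmap g (fst \<nu>, es) \<cdot> edge_path E f'"
    using partial_isoD(7)[OF g] \<nu>(1) by metis
  \<comment> \<open>Two expressions for the image of \<open>\<nu>\<close> each end in a single edge;
    removing it leaves equal prefixes.\<close>
  with \<nu>(2) have "pmap g (fst \<nu>, es) = \<mu>"
    by (auto simp: concat_path_def edge_path_def prod_eq_iff)
  moreover have "(fst \<nu>, es) \<in> paths_at E (pdom g)"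
    using \<nu>(1) \<nu>' by (metis concat_edge_in_paths_at_iff)
  ultimately have "(fst \<nu>, es) = pmap ?k \<mu>"
    using pmap_piso_inv(1)[OF g] by metis
  with \<nu>' show "\<exists>f. pmap ?k (\<mu> \<cdot> edge_path E e) = pmap ?k \<mu> \<cdot> edge_path E f"
    by (auto simp: \<nu>_def)
qed (use partial_isoD[OF g] in \<open>auto simp: piso_inv_def\<close>)

lemma inverse_arr_piso_inv:
  assumes g: "partial_iso E g"
  shows "inverse_arr (PIso E) g (piso_inv E g)"
  unfolding inverse_arr_def
  by (auto simp: partial_iso_piso_inv[OF g] compose_def pmap_piso_inv[OF g]
      intro!: piso_eqI restrict_ext)

text \<open>Stated for an arbitrary inverse \<open>k\<close> and not just for
  \<open>piso_inv\<close>, because \<open>is_subgroupoid\<close> asks for closure under every arrow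
  satisfying \<open>inverse_arr\<close>.\<close>

lemma inverse_arr_PIsoD:
  assumes "inverse_arr (PIso E) g k"
  shows "partial_iso E k" "pdom k = pcod g" "pcod k = pdom g"
    and "\<mu> \<in> paths_at E (pdom g) \<Longrightarrow> pmap k (pmap g \<mu>) = \<mu>"
    and "\<nu> \<in> paths_at E (pcod g) \<Longrightarrow> pmap g (pmap k \<nu>) = \<nu>"
proof -
  show k: "partial_iso E k" "pdom k = pcod g" "pcod k = pdom g"
    using assms by (auto simp: inverse_arr_def)
  have kg: "Comp (PIso E) k g = Ident (PIso E) (pdom g)"
    and gk: "Comp (PIso E) g k = Ident (PIso E) (pcod g)"
    using assms by (auto simp: inverse_arr_def)
  show "pmap k (pmap g \<mu>) = \<mu>" if "\<mu> \<in> paths_at E (pdom g)"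
    using fun_cong[OF arg_cong[OF kg, of pmap], of \<mu>] that by (simp add: compose_eq)
  show "pmap g (pmap k \<nu>) = \<nu>" if "\<nu> \<in> paths_at E (pcod g)"
    using fun_cong[OF arg_cong[OF gk, of pmap], of \<nu>] that k by (simp add: compose_eq)
qed

lemma groupoid_PIso: "groupoid (PIso E)"
proof
  fix g h k
  assume "g \<in> Arr (PIso E)" "h \<in> Arr (PIso E)" "k \<in> Arr (PIso E)"
    and "Dom (PIso E) g = Cod (PIso E) h" "Dom (PIso E) h = Cod (PIso E) k"
  then show "Comp (PIso E) (Comp (PIso E) g h) k = Comp (PIso E) g (Comp (PIso E) h k)"
    by (auto intro!: piso_eqI simp: compose_def fun_eq_iff partial_isoD(5))
next
  fix g assume g: "g \<in> Arr (PIso E)"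
  \<comment> \<open>Composition cuts maps down to the domain, so the unit laws return
    \<open>g\<close> itself only because its map is already \<open>undefined\<close>
    elsewhere.\<close>
  then have ext: "pmap g \<in> extensional (paths_at E (pdom g))"
    by (simp add: partial_isoD(3))
  show "Comp (PIso E) g (Ident (PIso E) (Dom (PIso E) g)) = g"
    using ext by (auto intro!: piso_eqI simp: compose_def fun_eq_iff extensional_def)
  show "Comp (PIso E) (Ident (PIso E) (Cod (PIso E) g)) g = g"
    using ext g by (auto intro!: piso_eqI simp: compose_def fun_eq_iff extensional_def partial_isoD(5))
  show "\<exists>h. inverse_arr (PIso E) g h"
    using g inverse_arr_piso_inv by auto
qed (auto simp: partial_isoD partial_iso_Ident partial_iso_Comp)


section \<open>The partial isomorphisms of an automaton\<close>

context automaton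
begin

lemma length_act_word [simp]: "length (act_word A a es) = length es"
  by (induction es arbitrary: a) auto

text \<open>The automaton reads from the left, so a letter appended at the end cannot affect earlier
  output.\<close>

lemma act_word_snoc: "\<exists>f. act_word A a (es @ [e]) = act_word A a es @ [f]"
  by (induction es arbitrary: a) auto

lemma act_in_edges_at:
  "\<lbrakk>a \<in> states A; e \<in> edges_at E (src A a)\<rbrakk> \<Longrightarrow> act A a e \<in> edges_at E (rng A a)"
  using bij_betw_apply[OF A1] .

text \<open>By \<open>A1\<close> the first output edge has range \<open>rng A a\<close>. Then
  \<open>A2\<close> allows the state \<open>res A a e\<close> to read the remaining path, and
  \<open>tail_act\<close> makes its output composable with that edge.\<close>

lemma act_word_in_paths_at:
  "\<lbrakk>a \<in> states A; (src A a, es) \<in> paths_at E (src A a)\<rbrakk> \<Longrightarrow>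
    (rng A a, act_word A a es) \<in> paths_at E (rng A a)"
proof (induction es arbitrary: a)
  case Nil
  then show ?case
    using vertex_path_in_paths_at[OF rng_in] by (simp add: vertex_path_def)
next
  case (Cons e es)
  then show ?case
    by (simp add: paths_at_cons_iff'[OF wf_digraph] act_in_edges_at tail_act res_in A2)
qed

text \<open>Injectivity in \<open>A1\<close> forces the first edges to agree. The remaining words
  are then read from the same state, so the induction continues.\<close>

lemma act_word_inj:
  "\<lbrakk>a \<in> states A; (src A a, es) \<in> paths_at E (src A a); (src A a, fs) \<in> paths_at E (src A a);
    act_word A a es = act_word A a fs\<rbrakk> \<Longrightarrow> es = fs"
proof (induction es arbitrary: a fs)
  case Nil
  then show ?case by (cases fs) auto
next
  case (Cons e es)
  then obtain f gs where fs: "fs = f # gs"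
    by (cases fs) auto
  have e: "e \<in> edges_at E (src A a)" and f: "f \<in> edges_at E (src A a)"
    and es: "(tail E e, es) \<in> paths_at E (tail E e)"
    and gs: "(tail E f, gs) \<in> paths_at E (tail E f)"
    using Cons.prems fs by (auto simp: paths_at_cons_iff'[OF wf_digraph])
  have "e = f"
    using Cons.prems(1,4) fs e f A1 by (auto simp: bij_betw_def dest: inj_onD)
  then show ?case
    using Cons.IH[of "res A a e" gs] Cons.prems(1,4) fs e es gs by (simp add: res_in A2)
qed

text \<open>The preimage is built from the left: \<open>A1\<close> lifts the first edge
  \<open>f\<close> to some \<open>e\<close>, and by \<open>tail_act\<close> the rest of the word
  starts at the range of the state \<open>res A a e\<close>, which lifts it in turn.\<close>

lemma act_word_surj:
  "\<lbrakk>a \<in> states A; (rng A a, fs) \<in> paths_at E (rng A a)\<rbrakk> \<Longrightarrow>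
    \<exists>es. (src A a, es) \<in> paths_at E (src A a) \<and> act_word A a es = fs"
proof (induction fs arbitrary: a)
  case Nil
  then show ?case
    using vertex_path_in_paths_at[OF src_in] by (auto simp: vertex_path_def intro!: exI[of _ "[]"])
next
  case (Cons f fs)
  have f: "f \<in> edges_at E (rng A a)" and fs: "(tail E f, fs) \<in> paths_at E (tail E f)"
    using Cons.prems by (auto simp: paths_at_cons_iff'[OF wf_digraph])
  have "f \<in> act A a ` edges_at E (src A a)"
    using f bij_betw_imp_surj_on[OF A1[OF Cons.prems(1)]] by simp
  then obtain e where e: "e \<in> edges_at E (src A a)" "act A a e = f"
    by blast
  obtain es where "(tail E e, es) \<in> paths_at E (tail E e)" "act_word A (res A a e) es = fs"
    using Cons.IH[of "res A a e"] Cons.prems(1) e fs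
    by (auto simp: res_in A2 tail_act[symmetric])
  then show ?case
    using e by (intro exI[of _ "e # es"]) (simp add: paths_at_cons_iff'[OF wf_digraph])
qed

lemma aut_piso_simps [simp]:
  "pdom (aut_piso E A a) = src A a" "pcod (aut_piso E A a) = rng A a"
  by (simp_all add: aut_piso_def)

text \<open>This places the generators among the arrows of \<open>PIso E\<close>, so that the
  intersection defining the generated groupoid is over a nonempty family.\<close>

lemma partial_iso_aut_piso:
  assumes a: "a \<in> states A"
  shows "partial_iso E (aut_piso E A a)"
proof (rule partial_isoI)
  let ?g = "aut_piso E A a"
  have pmap: "pmap ?g \<mu> = (rng A a, act_word A a (snd \<mu>))" if "\<mu> \<in> paths_at E (src A a)" for \<mu>
    using that by (simp add: aut_piso_def)
  have "inj_on (pmap ?g) (paths_at E (src A a))"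
    by (rule inj_onI) (metis Pair_inject act_word_inj a pmap rng_paths_at)
  moreover have "pmap ?g ` paths_at E (src A a) = paths_at E (rng A a)"
  proof (intro equalityI subsetI)
    fix \<nu> assume \<nu>: "\<nu> \<in> paths_at E (rng A a)"
    then obtain es where "(src A a, es) \<in> paths_at E (src A a)" "act_word A a es = snd \<nu>"
      using act_word_surj[OF a, of "snd \<nu>"] rng_paths_at[OF \<nu>] by auto
    then show "\<nu> \<in> pmap ?g ` paths_at E (src A a)"
      using rng_paths_at[OF \<nu>] by (force simp: pmap intro: rev_image_eqI)
  next
    fix \<nu> assume "\<nu> \<in> pmap ?g ` paths_at E (src A a)"
    then show "\<nu> \<in> paths_at E (rng A a)"
      using act_word_in_paths_at[OF a] rng_paths_at by (fastforce simp: pmap)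
  qed
  ultimately show "bij_betw (pmap ?g) (paths_at E (pdom ?g)) (paths_at E (pcod ?g))"
    by (simp add: bij_betw_def)
  fix \<mu> assume \<mu>: "\<mu> \<in> paths_at E (pdom ?g)"
  then show "length (snd (pmap ?g \<mu>)) = length (snd \<mu>)"
    by (simp add: pmap)
  fix e assume "\<mu> \<cdot> edge_path E e \<in> paths_at E (pdom ?g)"
  then show "\<exists>f. pmap ?g (\<mu> \<cdot> edge_path E e) = pmap ?g \<mu> \<cdot> edge_path E f"
    using \<mu> act_word_snoc[of a "snd \<mu>" e] by (auto simp: pmap) (auto simp: concat_path_def edge_path_def)
qed (use a in \<open>auto simp: src_in rng_in aut_piso_def\<close>)

end


section \<open>Restrictions\<close>

text \<open>The self-similarity condition for the inclusion into \<open>PIso E\<close>, with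
  \<open>h\<close> in the role of \<open>g|\<^sub>e\<close>. Membership of \<open>h\<close> in a
  particular subgroupoid is left out and imposed separately.\<close>

definition is_restriction ::
    "('a, 'e) pre_digraph \<Rightarrow> ('a, 'e) piso \<Rightarrow> 'e \<Rightarrow> ('a, 'e) piso \<Rightarrow> bool" where
  "is_restriction E g e h \<longleftrightarrow> pdom h = tail E e \<and> pcod h = src_path E (pmap g (edge_path E e))
     \<and> (\<forall>\<mu>\<in>paths_at E (tail E e).
          pmap g (edge_path E e \<cdot> \<mu>) = pmap g (edge_path E e) \<cdot> pmap h \<mu>)"

context wf_digraph
begin

text \<open>Inside the locale \<open>wf_digraph\<close> the letter \<open>G\<close> is the graph,
  not a groupoid.\<close>

lemma edge_path_in_paths_at: "e \<in> edges_at G v \<Longrightarrow> edge_path G e \<in> paths_at G v"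
  using paths_at_cons_iff'[OF wf_digraph_axioms, of v e "[]"] vertex_path_in_paths_at[of "tail G e" G]
  by (auto simp: edge_path_def edges_at_def vertex_path_def)

lemma edge_path_concat_in_paths_at:
  assumes "e \<in> edges_at G v" "\<mu> \<in> paths_at G (tail G e)"
  shows "edge_path G e \<cdot> \<mu> \<in> paths_at G v"
  using assms rng_paths_at[OF assms(2)] paths_at_cons_iff'[OF wf_digraph_axioms, of v e "snd \<mu>"]
  by (auto simp: edge_path_def concat_path_def edges_at_def)

text \<open>Length preservation sends a path of length one to a path of length one, so the image can
  be named by an edge at which a restriction may be taken again.\<close>

lemma partial_iso_edge:
  assumes g: "partial_iso G g" and e: "e \<in> edges_at G (pdom g)"
  obtains f where "f \<in> edges_at G (pcod g)" "pmap g (edge_path G e) = edge_path G f"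
proof -
  let ?\<nu> = "pmap g (edge_path G e)"
  have \<nu>: "?\<nu> \<in> paths_at G (pcod g)" and "length (snd ?\<nu>) = 1"
    using partial_isoD(5,6)[OF g edge_path_in_paths_at[OF e]] by (auto simp: edge_path_def)
  then obtain f where "snd ?\<nu> = [f]"
    by (auto simp: length_Suc_conv)
  with rng_paths_at[OF \<nu>] have eq: "?\<nu> = (pcod g, [f])"
    by simp
  then have "f \<in> edges_at G (pcod g)"
    using \<nu> paths_at_cons_iff'[OF wf_digraph_axioms, of "pcod g" f "[]"] by simp
  then show thesis
    using eq that by (auto simp: edge_path_def edges_at_def)
qed

lemma is_restriction_Ident:
  assumes "e \<in> edges_at G v"
  shows "is_restriction G (Ident (PIso G) v) e (Ident (PIso G) (tail G e))"
  using assms edge_path_in_paths_at[OF assms] edge_path_concat_in_paths_at[OF assms]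
  by (simp add: is_restriction_def) (simp add: src_path_def edge_path_def)

text \<open>First \<open>g'\<close> turns \<open>e\<mu>\<close> into \<open>f\<close> followed by
  \<open>h'\<mu>\<close>; then \<open>g\<close> acts on \<open>f\<close> and leaves \<open>h\<close>
  to act on \<open>h'\<mu>\<close>. The restrictions are composable since both \<open>pdom h\<close>
  and \<open>pcod h'\<close> are the source of \<open>f\<close>.\<close>

lemma is_restriction_Comp:
  assumes e: "e \<in> edges_at G (pdom g')"
    and f: "pmap g' (edge_path G e) = edge_path G f"
    and h': "is_restriction G g' e h'" "partial_iso G h'" and h: "is_restriction G g f h"
  shows "pdom h = pcod h'" "is_restriction G (Comp (PIso G) g g') e (Comp (PIso G) h h')"
proof -
  have src: "src_path G (edge_path G f) = tail G f"
    by (simp add: src_path_def edge_path_def)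
  show hh': "pdom h = pcod h'"
    using h' h f src by (simp add: is_restriction_def)
  show "is_restriction G (Comp (PIso G) g g') e (Comp (PIso G) h h')"
    using h' h f src edge_path_in_paths_at[OF e] edge_path_concat_in_paths_at[OF e]
      partial_isoD(5)[OF h'(2)] hh'
    by (simp add: is_restriction_def compose_eq)
qed

text \<open>The map \<open>g\<close> sends \<open>f\<close> followed by \<open>l\<mu>\<close> to
  \<open>e\<close> followed by \<open>h(l\<mu>) = \<mu>\<close>. Applying \<open>k\<close> to both
  sides gives the claim.\<close>

lemma is_restriction_inverse:
  assumes k: "inverse_arr (PIso G) g k"
    and e: "e \<in> edges_at G (pdom k)" and f: "pmap k (edge_path G e) = edge_path G f"
    and h: "is_restriction G g f h" and l: "inverse_arr (PIso G) h l"
    and f_in: "f \<in> edges_at G (pdom g)"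
  shows "is_restriction G k e l"
  unfolding is_restriction_def
proof (intro conjI ballI)
  note kD = inverse_arr_PIsoD[OF k] and lD = inverse_arr_PIsoD[OF l]
  have src: "src_path G (edge_path G e') = tail G e'" for e'
    by (simp add: src_path_def edge_path_def)
  have gf: "pmap g (edge_path G f) = edge_path G e"
    using kD(5)[of "edge_path G e"] edge_path_in_paths_at[OF e] f kD(2) by simp
  have hD: "pdom h = tail G f" "pcod h = tail G e"
    using h src gf by (auto simp: is_restriction_def)
  show "pdom l = tail G e" "pcod l = src_path G (pmap k (edge_path G e))"
    using lD(2,3) hD f src by auto
  fix \<mu> assume \<mu>: "\<mu> \<in> paths_at G (tail G e)"
  then have l\<mu>: "pmap l \<mu> \<in> paths_at G (tail G f)"
    using partial_isoD(5)[OF lD(1), of \<mu>] lD(2,3) hD by simp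
  then have "pmap g (edge_path G f \<cdot> pmap l \<mu>) = edge_path G e \<cdot> pmap h (pmap l \<mu>)"
    using h gf by (simp add: is_restriction_def)
  also have "\<dots> = edge_path G e \<cdot> \<mu>"
    using lD(5) \<mu> hD by simp
  finally show "pmap k (edge_path G e \<cdot> \<mu>) = pmap k (edge_path G e) \<cdot> pmap l \<mu>"
    using kD(4)[OF edge_path_concat_in_paths_at[OF f_in l\<mu>]] f by simp
qed

text \<open>Restrictions are required to lie in the given \<open>H\<close> and not in the smaller
  set being defined, which keeps the definition free of recursion.\<close>

lemma is_subgroupoid_restrictable:
  assumes H: "is_subgroupoid H (PIso G)"
  shows "is_subgroupoid {g \<in> H. \<forall>e\<in>edges_at G (pdom g). \<exists>h\<in>H. is_restriction G g e h} (PIso G)"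
    (is "is_subgroupoid ?R _")
  unfolding is_subgroupoid_def
proof (intro conjI ballI allI impI)
  note HD = is_subgroupoidD[OF H]
  have piso: "partial_iso G g" if "g \<in> H" for g
    using HD(1)[OF that] by simp
  show "?R \<subseteq> Arr (PIso G)"
    using piso by auto
  show "Ident (PIso G) v \<in> ?R" if "v \<in> Unit (PIso G)" for v
  proof -
    have "Ident (PIso G) (tail G e) \<in> H" if "e \<in> edges_at G v" for e
      using HD(2) that by (auto simp: edges_at_def)
    with HD(2)[OF that] is_restriction_Ident show ?thesis by auto
  qed
  fix g assume "g \<in> ?R"
  then have g: "g \<in> H" and resg: "\<And>e. e \<in> edges_at G (pdom g) \<Longrightarrow> \<exists>h\<in>H. is_restriction G g e h"
    by auto
  show "Comp (PIso G) g g' \<in> ?R" if "g' \<in> ?R" "Dom (PIso G) g = Cod (PIso G) g'" for g'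
  proof -
    have g': "g' \<in> H" and gg': "pdom g = pcod g'" using that by auto
    have "\<exists>h\<in>H. is_restriction G (Comp (PIso G) g g') e h" if e: "e \<in> edges_at G (pdom g')" for e
    proof -
      obtain f where f: "f \<in> edges_at G (pcod g')" "pmap g' (edge_path G e) = edge_path G f"
        using partial_iso_edge[OF piso[OF g'] e] .
      obtain h where h: "h \<in> H" "is_restriction G g f h"
        using resg f gg' by auto
      obtain h' where h': "h' \<in> H" "is_restriction G g' e h'"
        using \<open>g' \<in> ?R\<close> e by auto
      note * = is_restriction_Comp[OF e f(2) h'(2) piso[OF h'(1)] h(2)]
      show ?thesis
        using HD(3)[OF h(1) h'(1)] * by auto
    qed
    then show ?thesis
      using HD(3)[OF g g'] gg' by auto
  qed
  show "k \<in> ?R" if k: "inverse_arr (PIso G) g k" for k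
  proof -
    note kD = inverse_arr_PIsoD[OF k]
    have "\<exists>l\<in>H. is_restriction G k e l" if e: "e \<in> edges_at G (pdom k)" for e
    proof -
      obtain f where f: "f \<in> edges_at G (pcod k)" "pmap k (edge_path G e) = edge_path G f"
        using partial_iso_edge[OF kD(1) e] .
      then have f_in: "f \<in> edges_at G (pdom g)"
        using kD(3) by simp
      then obtain h where h: "h \<in> H" "is_restriction G g f h"
        using resg by auto
      \<comment> \<open>The restriction of \<open>k\<close> at \<open>e\<close> is the inverse of
        the restriction of \<open>g\<close> at the edge \<open>f\<close> obtained by applying
        \<open>k\<close> to \<open>e\<close>.\<close>
      have l: "inverse_arr (PIso G) h (piso_inv G h)"
        using inverse_arr_piso_inv piso[OF h(1)] .
      from HD(4)[OF h(1) l] is_restriction_inverse[OF k e f(2) h(2) l f_in]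
      show ?thesis by blast
    qed
    then show ?thesis
      using HD(4)[OF g k] by auto
  qed
qed

end

text \<open>The recursion defining \<open>aut_piso\<close> is the restriction identity;
  \<open>A2\<close> and \<open>tail_act\<close> match the domain and codomain.\<close>

lemma (in automaton) is_restriction_aut_piso:
  assumes a: "a \<in> states A" and e: "e \<in> edges_at E (src A a)"
  shows "is_restriction E (aut_piso E A a) e (aut_piso E A (res A a e))"
  unfolding is_restriction_def
  using aut_piso_recursion(2,3)[OF a e] tail_act[OF a e] A2[OF a e]
  by (simp add: src_path_def edge_path_def)


section \<open>The inclusion of the automaton groupoid as a faithful self-similar action\<close>

theorem theorem3p9:
  fixes E :: "('a, 'e) pre_digraph" and A :: "('a, 'e) automaton"
  assumes "wf_digraph E" and "automaton E A"
  shows "faithful_action E (automaton_groupoid E A) (\<lambda>g. g)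
    \<and> self_similar_action E (automaton_groupoid E A) (\<lambda>g. g)"
proof -
  interpret wf_digraph E by fact
  interpret automaton E A by fact
  interpret P: groupoid "PIso E" by (rule groupoid_PIso)
  let ?S = "aut_piso E A ` states A"
  define H where "H = Arr (automaton_groupoid E A)"
  \<comment> \<open>All fields but the arrow set are those of \<open>PIso E\<close>, which is the
    form needed by \<open>groupoid_subgroupoid\<close>.\<close>
  have eq: "automaton_groupoid E A = PIso E\<lparr>Arr := H\<rparr>"
    by (simp add: H_def automaton_groupoid_def generated_subgroupoid_def)
  have H: "is_subgroupoid H (PIso E)"
    unfolding H_def automaton_groupoid_def
    by (rule P.is_subgroupoid_generated) (auto simp: partial_iso_aut_piso)
  have gen: "aut_piso E A a \<in> H" if "a \<in> states A" for a
    unfolding H_def automaton_groupoid_def using that by (intro generator_in_generated) auto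
  let ?R = "{g \<in> H. \<forall>e\<in>edges_at E (pdom g). \<exists>h\<in>H. is_restriction E g e h}"
  have "?S \<subseteq> ?R"
  proof clarify
    fix a assume a: "a \<in> states A"
    then have "\<exists>h\<in>H. is_restriction E (aut_piso E A a) e h" if "e \<in> edges_at E (src A a)" for e
      using is_restriction_aut_piso gen res_in that by blast
    with gen[OF a] show "aut_piso E A a \<in> H \<and>
        (\<forall>e\<in>edges_at E (pdom (aut_piso E A a)). \<exists>h\<in>H. is_restriction E (aut_piso E A a) e h)"
      by simp
  qed
  \<comment> \<open>Minimality of the generated subgroupoid: \<open>?R\<close> is a subgroupoid
    containing all generators.\<close>
  then have "H \<subseteq> ?R"
    using generated_subset[OF is_subgroupoid_restrictable[OF H]]
    by (simp only: H_def automaton_groupoid_def)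
  then have restr: "\<exists>h\<in>H. is_restriction E g e h" if "g \<in> H" "e \<in> edges_at E (pdom g)" for g e
    using that by blast
  interpret GA: groupoid "PIso E\<lparr>Arr := H\<rparr>"
    by (rule P.groupoid_subgroupoid[OF H])
  \<comment> \<open>The action is the inclusion of \<open>H\<close>, so the homomorphism laws and
    injectivity are immediate.\<close>
  interpret faithful_action E "PIso E\<lparr>Arr := H\<rparr>" "\<lambda>g. g"
    by unfold_locales (use is_subgroupoidD(1)[OF H] in auto)
  have "self_similar_action E (PIso E\<lparr>Arr := H\<rparr>) (\<lambda>g. g)"
    by unfold_locales (use restr in \<open>simp add: is_restriction_def\<close>)
  then show ?thesis
    unfolding eq using faithful_action_axioms by blast
qed

end
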